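(* Let $p>3$ be a prime and let $a\in\mathbb Z_p$ with $a\not\equiv 0,-1,\frac12,-\frac12\pmod p$. Put $t=(a-\langle a\rangle_p)/p$. Then $$\sum_{k=0}^{p-1}\binom ak\binom{-1-a}k\frac 1{2k-1}\equiv -(2a+1)(2t+1)-p^2t(t+1)\big(4+(2a+1)B_{p-2}(-a)\big)\pmod{p^3}.$$
   Context: $\mathbb Z_p$ denotes the set of rational numbers whose denominator is not divisible by $p$. For $x,y\in\mathbb Q$, $x\equiv y\pmod{p^m}$ means $(x-y)/p^m\in\mathbb Z_p$. For $a\in\mathbb Z_p$, $\langle a\rangle_p\in\{0,1,\ldots,p-1\}$ is defined by $a\equiv\langle a\rangle_p\pmod p$. For rational $a$ and integer $k\ge0$, $\binom ak=a(a-1)\cdots(a-k+1)/k!$. The Bernoulli numbers are defined by $B_0=1$, $\sum_{k=0}^{n-1}\binom nkB_k=0$ for $n\ge2$, and the Bernoulli polynomials by $B_n(x)=\sum_{k=0}^n\binom nkB_kx^{n-k}$. *)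

theory Defs
  imports Complex_Main "HOL-Computational_Algebra.Primes"
begin

definition Zp :: "nat \<Rightarrow> rat set" where
  "Zp p = {x. \<not> int p dvd snd (quotient_of x)}"

definition qcong :: "nat \<Rightarrow> nat \<Rightarrow> rat \<Rightarrow> rat \<Rightarrow> bool" where
  "qcong p m x y \<longleftrightarrow> (x - y) / of_nat p ^ m \<in> Zp p"

(* For a prime p and a in Zp p such an r exists and is unique; outside that
   case the description carries no information. *)
definition least_residue :: "nat \<Rightarrow> rat \<Rightarrow> nat" where
  "least_residue p a = (THE r. r < p \<and> qcong p 1 a (of_nat r))"

(* The recurrence of bernoulli_recurrence below, for n + 2 in place of n and
   solved for its last term, whose coefficient is n + 2.
   In particular bernoulli 1 = -1/2. *)
fun bernoulli :: "nat \<Rightarrow> rat" where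
  "bernoulli 0 = 1"
| "bernoulli (Suc n) =
     - (\<Sum>k\<le>n. of_nat ((n + 2) choose k) * bernoulli k) / of_nat (n + 2)"

lemma bernoulli_recurrence:
  assumes "n \<ge> 2"
  shows "(\<Sum>k<n. of_nat (n choose k) * bernoulli k) = 0"
proof -
  obtain m where n: "n = Suc (Suc m)"
    using assms by (metis Suc_le_D numeral_2_eq_2 Suc_le_mono)
  have "(Suc (Suc m)) choose (Suc m) = m + 2"
    using binomial_symmetric[of "Suc m" "Suc (Suc m)"] by simp
  moreover have "(of_nat (m + 2) :: rat) \<noteq> 0"
    unfolding of_nat_eq_0_iff by simp
  ultimately show ?thesis
    unfolding n lessThan_Suc_atMost atMost_Suc
    by (simp del: of_nat_add of_nat_Suc binomial_Suc_Suc)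
qed

definition bernpoly :: "nat \<Rightarrow> rat \<Rightarrow> rat" where
  "bernpoly n x = (\<Sum>k\<le>n. of_nat (n choose k) * bernoulli k * x ^ (n - k))"


end

(* Dividing the sum f(a) by 2a + 1 gives g(a), and (2a - 1) f(a) - (2a + 1) f(a - 1) is an explicit
   product of two binomial coefficients, so that g(a) - g(a - 1) = 2 P(a) / (4a^2 - 1) with
   P(a) = binom(a - 1, p - 1) binom(-a - 1, p - 1).  For a = pt + j with 0 < j < p, P(a) is congruent to
   p^2 t (t + 1) / j^2 modulo p^3.  Telescoping from pt to pt + r involves only 1 / (2r + 1) and the
   sum of 1 / j^2 for j <= r, as long as 2r + 1 < p; the symmetry of f under a -> -1 - a covers
   the other residues.  By B_n(x + 1) - B_n(x) = n x^(n - 1) and Fermat's little theorem,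
   twice the sum of the 1 / j^2 is B_{p-2}(-r) modulo p.  Finally f(pt) is a
   quadratic polynomial in t modulo p^3, which is found by interpolation at t = 0, 1, -1: the
   values there come from the recurrence and f(-p) = f(p - 1). *)
theory Submission
  imports Defs "HOL-Computational_Algebra.Formal_Power_Series" "HOL-Number_Theory.Number_Theory"
begin

declare One_nat_def [simp del]

section \<open>The ring of p-integral rationals\<close>

lemma Zp_iff_fraction:
  assumes "prime p"
  shows "x \<in> Zp p \<longleftrightarrow> (\<exists>n d. \<not> int p dvd d \<and> x = of_int n / of_int d)"
proof
  assume "x \<in> Zp p"
  moreover obtain n d where nd: "quotient_of x = (n, d)" by fastforce
  ultimately have "\<not> int p dvd d" by (simp add: Zp_def)
  with quotient_of_div[OF nd] show "\<exists>n d. \<not> int p dvd d \<and> x = of_int n / of_int d" by blast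
next
  assume "\<exists>n d. \<not> int p dvd d \<and> x = of_int n / of_int d"
  then obtain n d where d: "\<not> int p dvd d" and x: "x = of_int n / of_int d" by blast
  obtain u v where uv: "quotient_of x = (u, v)" by fastforce
  have v: "v > 0" "coprime u v" "x = of_int u / of_int v"
    using quotient_of_denom_pos[OF uv] quotient_of_coprime[OF uv] quotient_of_div[OF uv] by auto
  have "d \<noteq> 0" using d by auto
  with v x have "rat_of_int (u * d) = rat_of_int (n * v)" by (simp add: field_simps)
  then have eq: "u * d = n * v" by (simp only: of_int_eq_iff)
  have "\<not> int p dvd v"
  proof
    assume pv: "int p dvd v"
    then have "int p dvd u * d" using eq by simp
    moreover have pp: "prime (int p)" using assms by simp
    ultimately have "int p dvd u" using d prime_dvd_mult_iff by blast
    with pv v(2) have "is_unit (int p)" using coprime_common_divisor by blast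
    with pp show False using not_prime_unit by blast
  qed
  then show "x \<in> Zp p" by (simp add: Zp_def uv)
qed

context
  fixes p :: nat
  assumes prime: "prime p"
begin

lemma p_nonzero: "rat_of_nat p \<noteq> 0"
  using prime prime_gt_0_nat by simp

lemma Zp_of_int [simp]: "of_int n \<in> Zp p"
proof -
  have "\<not> int p dvd 1" using prime prime_gt_1_nat by fastforce
  then show ?thesis using Zp_iff_fraction[OF prime] by (metis div_by_1 of_int_1)
qed

lemma Zp_of_nat [simp]: "of_nat n \<in> Zp p"
  by (metis Zp_of_int of_int_of_nat_eq)

lemma Zp_numeral [simp]: "numeral n \<in> Zp p"
  by (metis Zp_of_nat of_nat_numeral)

lemma Zp_0 [simp]: "0 \<in> Zp p" and Zp_1 [simp]: "1 \<in> Zp p"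
  using Zp_of_nat[of 0] Zp_of_nat[of 1] by simp_all

lemma Zp_add [simp]:
  assumes "x \<in> Zp p" "y \<in> Zp p" shows "x + y \<in> Zp p"
proof -
  obtain n d m e where *: "\<not> int p dvd d" "x = of_int n / of_int d"
    "\<not> int p dvd e" "y = of_int m / of_int e"
    using assms Zp_iff_fraction[OF prime] by metis
  then have "d \<noteq> 0" "e \<noteq> 0" by auto
  then have "x + y = of_int (n * e + m * d) / of_int (d * e)"
    using * by (simp add: field_simps)
  moreover have "\<not> int p dvd d * e" using * prime by (simp add: prime_dvd_mult_iff)
  ultimately show ?thesis using Zp_iff_fraction[OF prime] by blast
qed

lemma Zp_mult [simp]:
  assumes "x \<in> Zp p" "y \<in> Zp p" shows "x * y \<in> Zp p"
proof -
  obtain n d m e where *: "\<not> int p dvd d" "x = of_int n / of_int d"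
    "\<not> int p dvd e" "y = of_int m / of_int e"
    using assms Zp_iff_fraction[OF prime] by metis
  then have "x * y = of_int (n * m) / of_int (d * e)" by simp
  moreover have "\<not> int p dvd d * e" using * prime by (simp add: prime_dvd_mult_iff)
  ultimately show ?thesis using Zp_iff_fraction[OF prime] by blast
qed

lemma Zp_minus [simp]: "x \<in> Zp p \<Longrightarrow> - x \<in> Zp p"
  using Zp_mult[OF Zp_of_int[of "-1"], of x] by simp

lemma Zp_diff [simp]: "x \<in> Zp p \<Longrightarrow> y \<in> Zp p \<Longrightarrow> x - y \<in> Zp p"
  using Zp_add[of x "- y"] by simp

lemma Zp_power [simp]: "x \<in> Zp p \<Longrightarrow> x ^ n \<in> Zp p"
  by (induction n) simp_all

lemma Zp_sum: "(\<And>i. i \<in> A \<Longrightarrow> f i \<in> Zp p) \<Longrightarrow> sum f A \<in> Zp p"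
  by (induction A rule: infinite_finite_induct) simp_all

section \<open>Congruence calculus on rationals\<close>

lemma qcong_iff: "qcong p m x y \<longleftrightarrow> (\<exists>z\<in>Zp p. x = y + of_nat p ^ m * z)"
  using p_nonzero unfolding qcong_def
  by (auto simp: field_simps intro!: bexI[of _ "(x - y) / of_nat p ^ m"])

lemma qcong_0_iff: "qcong p m x 0 \<longleftrightarrow> (\<exists>z\<in>Zp p. x = of_nat p ^ m * z)"
  by (simp add: qcong_iff)

lemma qcong_refl [simp]: "qcong p m x x"
  by (simp add: qcong_def)

lemma qcong_sym: "qcong p m x y \<Longrightarrow> qcong p m y x"
  using Zp_minus[of "(x - y) / of_nat p ^ m"] by (simp add: qcong_def minus_divide_left)

lemma qcong_add:
  assumes "qcong p m x y" "qcong p m u v" shows "qcong p m (x + u) (y + v)"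
  using Zp_add[OF assms[unfolded qcong_def]] by (simp add: qcong_def algebra_simps flip: add_divide_distrib)

lemma qcong_trans:
  assumes "qcong p m x y" "qcong p m y z" shows "qcong p m x z"
  using qcong_add[OF assms] by (simp add: qcong_def)

lemma qcong_minus: "qcong p m x y \<Longrightarrow> qcong p m (- x) (- y)"
  using qcong_sym by (simp add: qcong_def)

lemma qcong_diff:
  "qcong p m x y \<Longrightarrow> qcong p m u v \<Longrightarrow> qcong p m (x - u) (y - v)"
  using qcong_add[of m x y "- u" "- v"] qcong_minus by simp

lemma qcong_cmult:
  assumes "qcong p m x y" "c \<in> Zp p" shows "qcong p m (c * x) (c * y)"
  using Zp_mult[OF assms(2) assms(1)[unfolded qcong_def]]
  by (simp add: qcong_def right_diff_distrib)

text \<open>The chain passes through \<open>y * u\<close>, which fixes the two values whose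
  integrality is assumed.\<close>

lemma qcong_mult:
  assumes "qcong p m x y" "qcong p m u v" "u \<in> Zp p" "y \<in> Zp p"
  shows "qcong p m (x * u) (y * v)"
  using qcong_trans[OF qcong_cmult[OF assms(1,3)], of "y * v"] qcong_cmult[OF assms(2,4)]
  by (simp add: mult.commute)

lemma qcong_sum: "(\<And>i. i \<in> A \<Longrightarrow> qcong p m (f i) (g i)) \<Longrightarrow> qcong p m (sum f A) (sum g A)"
  by (induction A rule: infinite_finite_induct) (simp_all add: qcong_add)

lemma qcong_mem:
  assumes "qcong p m x y" "y \<in> Zp p" shows "x \<in> Zp p"
  using assms by (auto simp: qcong_iff)

lemma qcong_power:
  assumes "qcong p m x y" "y \<in> Zp p" shows "qcong p m (x ^ n) (y ^ n)"
  using assms qcong_mem[OF assms] by (induction n) (simp_all add: qcong_mult)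

text \<open>Raises the modulus: behind a factor p^2, a congruence modulo p suffices for one modulo
  p^3.\<close>

lemma qcong_scale: "qcong p m x y \<Longrightarrow> qcong p (n + m) (of_nat p ^ n * x) (of_nat p ^ n * y)"
  using p_nonzero by (simp add: qcong_def power_add flip: right_diff_distrib)

lemma qcong_p_0: "z \<in> Zp p \<Longrightarrow> qcong p m (of_nat p ^ m * z) 0"
  using qcong_0_iff by blast

lemma qcong_of_int_iff: "qcong p 1 (of_int n) 0 \<longleftrightarrow> int p dvd n"
proof
  assume "int p dvd n"
  then show "qcong p 1 (of_int n) 0" unfolding qcong_iff
    by (auto elim!: dvdE)
next
  assume "qcong p 1 (of_int n) 0"
  then obtain z where z: "z \<in> Zp p" "rat_of_int n = of_nat p * z"
    using qcong_0_iff[of 1] by auto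
  then obtain u v where v: "\<not> int p dvd v" and e: "rat_of_int n = of_nat p * (of_int u / of_int v)"
    using Zp_iff_fraction[OF prime] by metis
  from v have "v \<noteq> 0" by auto
  with e have "rat_of_int (n * v) = of_int (int p * u)" by (simp add: field_simps)
  then have "n * v = int p * u" by (simp only: of_int_eq_iff)
  then have "int p dvd n * v" by simp
  then show "int p dvd n" using v prime by (simp add: prime_dvd_mult_iff)
qed

lemma qcong_of_int: "qcong p 1 (of_int n) (of_int m) \<longleftrightarrow> [n = m] (mod int p)"
  using qcong_of_int_iff[of "n - m"] by (simp add: qcong_def cong_iff_dvd_diff)

section \<open>Inverses of p-integral units\<close>

lemma Zp_inverse:
  assumes "x \<in> Zp p" "\<not> qcong p 1 x 0" shows "inverse x \<in> Zp p"
proof -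
  obtain n d where nd: "\<not> int p dvd d" "x = of_int n / of_int d"
    using assms Zp_iff_fraction[OF prime] by metis
  have "\<not> int p dvd n"
  proof
    assume "int p dvd n"
    then have "qcong p 1 (of_int n) 0" using qcong_of_int_iff by simp
    then have "qcong p 1 (of_int n * inverse (of_int d)) 0"
      using nd(1) Zp_iff_fraction[OF prime] qcong_mult[of 1 "of_int n" 0 "inverse (of_int d)" "inverse (of_int d)"]
      by (simp add: inverse_eq_divide) (metis of_int_1)
    with assms nd show False by (simp add: divide_inverse)
  qed
  then show ?thesis using nd Zp_iff_fraction[OF prime] by auto
qed

lemma Zp_inverse_of_int: "\<not> int p dvd n \<Longrightarrow> inverse (of_int n) \<in> Zp p"
  by (intro Zp_inverse) (simp_all add: qcong_of_int_iff del: One_nat_def)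

lemma Zp_inverse_of_nat: "0 < k \<Longrightarrow> k < p \<Longrightarrow> inverse (of_nat k) \<in> Zp p"
  using Zp_inverse_of_int[of "int k"] by (simp add: nat_dvd_not_less)

lemma inverse_of_qcong:
  assumes "qcong p 1 x y" "y \<in> Zp p" "\<not> qcong p 1 y 0"
  shows "inverse x \<in> Zp p" and "qcong p 1 (inverse x) (inverse y)"
proof -
  have x: "x \<in> Zp p" using assms qcong_mem by blast
  have nx: "\<not> qcong p 1 x 0" using assms qcong_sym qcong_trans by blast
  show ix: "inverse x \<in> Zp p" by (rule Zp_inverse[OF x nx])
  have iy: "inverse y \<in> Zp p" using assms Zp_inverse by blast
  have "x \<noteq> 0" "y \<noteq> 0" using nx assms(3) by auto
  \<comment> \<open>Multiplying the congruence of \<open>y\<close> and \<open>x\<close> by the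
    p-integral number 1 / (x y) turns it into one between the inverses.\<close>
  then have "inverse x * inverse y * y = inverse x" "inverse x * inverse y * x = inverse y"
    by auto
  then show "qcong p 1 (inverse x) (inverse y)"
    using qcong_cmult[OF qcong_sym[OF assms(1)] Zp_mult[OF ix iy]] by metis
qed

lemma qcong_1_p_multiple: "z \<in> Zp p \<Longrightarrow> qcong p 1 (of_nat p * z + x) x"
  using qcong_add[OF qcong_p_0[of z 1] qcong_refl[of 1 x]] by simp

end

section \<open>Bernoulli polynomials\<close>

text \<open>The classical series X / (exp X - 1), as the next lemma confirms.\<close>

definition bern_fps :: "rat fps" where
  "bern_fps = Abs_fps (\<lambda>n. bernoulli n / fact n)"

text \<open>Coefficientwise this is the recurrence divided by n!; since exp X - 1 has no constant
  term, the sum stops before k = n. The indices 0 and 1 are checked directly.\<close>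

lemma bern_fps_mult_exp: "bern_fps * (fps_exp 1 - 1) = fps_X"
proof (rule fps_ext)
  fix n
  have "fps_nth (bern_fps * (fps_exp 1 - 1)) n =
      (\<Sum>k=0..n. bernoulli k / fact k * (if k = n then 0 else 1 / fact (n - k)))"
    unfolding fps_mult_nth by (intro sum.cong) (auto simp: bern_fps_def)
  also have "\<dots> = (\<Sum>k<n. bernoulli k / fact k * (1 / fact (n - k)))"
    unfolding atLeast0AtMost lessThan_Suc_atMost[symmetric] by (simp add: mult.commute)
  also have "\<dots> = (\<Sum>k<n. of_nat (n choose k) * bernoulli k) / fact n"
    unfolding sum_divide_distrib by (intro sum.cong) (auto simp: binomial_fact mult.commute)
  also have "\<dots> = fps_nth fps_X n"
  proof (cases "n \<ge> 2")
    case True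
    then show ?thesis by (simp add: bernoulli_recurrence fps_X_def)
  next
    case False
    then have "n = 0 \<or> n = 1" by auto
    then show ?thesis by (auto simp: One_nat_def)
  qed
  finally show "fps_nth (bern_fps * (fps_exp 1 - 1)) n = fps_nth fps_X n" .
qed

lemma bernpoly_conv_fps: "bernpoly n x = fact n * fps_nth (bern_fps * fps_exp x) n"
  unfolding fps_mult_nth bernpoly_def atLeast0AtMost sum_distrib_left
  by (intro sum.cong) (auto simp: bern_fps_def binomial_fact)

text \<open>The generating function of the left side is \<open>bern_fps\<close> times (exp X - 1)
  exp(x X), hence X exp(x X). For n = 0 the truncated exponent is harmless because of the factor
  n.\<close>

lemma bernpoly_add_one: "bernpoly n (x + 1) - bernpoly n x = of_nat n * x ^ (n - 1)"
proof -
  have "bern_fps * fps_exp (x + 1) - bern_fps * fps_exp x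
      = (bern_fps * (fps_exp 1 - 1)) * fps_exp x"
    by (simp add: fps_exp_add_mult algebra_simps)
  also have "\<dots> = fps_X * fps_exp x" by (simp only: bern_fps_mult_exp)
  finally have "fps_nth (bern_fps * fps_exp (x + 1)) n - fps_nth (bern_fps * fps_exp x) n = fps_nth (fps_X * fps_exp x) n"
    by (metis fps_sub_nth)
  then have "bernpoly n (x + 1) - bernpoly n x = fact n * fps_nth (fps_X * fps_exp x) n"
    by (simp add: bernpoly_conv_fps flip: right_diff_distrib)
  then show ?thesis
    by (cases n) (simp_all add: One_nat_def)
qed

text \<open>Expanding the fraction -X / (exp(-X) - 1) by exp X gives X exp X / (exp X - 1).\<close>

lemma bern_fps_compose_uminus: "bern_fps oo (- fps_X) = bern_fps * fps_exp 1"
proof -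
  let ?C = "bern_fps oo (- fps_X)"
  have "?C * (fps_exp (- 1) - 1) = - fps_X"
    using arg_cong[OF bern_fps_mult_exp, of "\<lambda>f. f oo (- fps_X)"]
    by (simp add: fps_compose_mult_distrib fps_compose_sub_distrib fps_exp_compose_linear
        flip: fps_const_neg[of 1, simplified])
  then have "?C * (fps_exp (- 1) - 1) * fps_exp 1 = - fps_X * fps_exp 1" by simp
  moreover have "(fps_exp (- 1) - 1) * fps_exp (1::rat) = - (fps_exp 1 - 1)"
    using fps_exp_add_mult[of "-1" "1::rat"] by (simp add: algebra_simps)
  ultimately have "?C * (fps_exp 1 - 1) = fps_X * fps_exp 1"
    by (metis (no_types, lifting) minus_mult_left minus_mult_right mult.assoc neg_equal_iff_equal)
  also have "\<dots> = (bern_fps * fps_exp 1) * (fps_exp 1 - 1)"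
    by (simp add: mult_ac flip: bern_fps_mult_exp)
  \<comment> \<open>The common factor exp X - 1 is nonzero, because its product with
    \<open>bern_fps\<close> is X, and may be cancelled.\<close>
  finally show ?thesis
    using bern_fps_mult_exp by (metis fps_X_neq_zero mult_cancel_right mult_zero_right)
qed

text \<open>Replacing X by -X in the generating function at x yields the one at 1 - x, and
  multiplies the n-th coefficient by (-1)^n.\<close>

lemma bernpoly_reflect: "bernpoly n (1 - x) = (- 1) ^ n * bernpoly n x"
proof -
  have "bern_fps * fps_exp (1 - x) = (bern_fps oo (- fps_X)) * (fps_exp x oo (- fps_X))"
    using fps_exp_add_mult[of 1 "- x"] fps_exp_compose_linear[of x "- 1"]
    by (simp add: bern_fps_compose_uminus mult.assoc flip: fps_const_neg)
  also have "\<dots> = (bern_fps * fps_exp x) oo (- fps_X)"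
    by (simp add: fps_compose_mult_distrib)
  finally show ?thesis
    by (simp add: bernpoly_conv_fps fps_compose_uminus' mult.left_commute)
qed

section \<open>The sum as a function of its argument\<close>

lemma gchoose_Suc:
  fixes x :: "'a :: field_char_0"
  shows "x gchoose Suc k = (x gchoose k) * (x - of_nat k) / (of_nat k + 1)"
proof -
  have "(of_nat k + 1 :: 'a) \<noteq> 0" by (metis of_nat_Suc of_nat_eq_0_iff add.commute nat.simps(3))
  then show ?thesis
    by (simp add: gbinomial_Suc gbinomial_prod_rev atLeast0_atMost_Suc atLeastLessThanSuc_atLeastAtMost[symmetric] field_simps)
qed

definition sum_term :: "rat \<Rightarrow> nat \<Rightarrow> rat" where
  "sum_term x k = (x gchoose k) * ((- 1 - x) gchoose k)"

definition sum_upto :: "nat \<Rightarrow> rat \<Rightarrow> rat" where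
  "sum_upto n x = (\<Sum>k<n. sum_term x k * (1 / (2 * of_nat k - 1)))"

lemma sum_upto_reflect: "sum_upto n (- 1 - x) = sum_upto n x"
  by (simp add: sum_upto_def sum_term_def mult.commute)

lemma of_nat_odd_neq_0: "2 * of_nat k - 1 \<noteq> (0 :: rat)"
proof
  assume "2 * of_nat k - 1 = (0 :: rat)"
  then have "rat_of_nat (2 * k) = of_nat 1" by simp
  then have "2 * k = 1" by (simp only: of_nat_eq_iff)
  then show False by presburger
qed

text \<open>Both sides change by the same amount when the upper limit grows by one, so the
  combination of two sums collapses to a closed product.\<close>

lemma sum_upto_recurrence:
  "(2 * x - 1) * sum_upto (Suc n) x - (2 * x + 1) * sum_upto (Suc n) (x - 1)
    = 2 * ((x - 1) gchoose n) * ((- x - 1) gchoose n)"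
proof (induction n)
  case 0
  then show ?case by (simp add: sum_upto_def sum_term_def)
next
  case (Suc n)
  define X where "X = ((x - 1) gchoose n)"
  define Y where "Y = ((- x - 1) gchoose n)"
  define m where "m = (of_nat n + 1 :: rat)"
  have m: "m \<noteq> 0" unfolding m_def by (metis of_nat_Suc of_nat_eq_0_iff add.commute nat.simps(3))
  have m2: "2 * m - 1 \<noteq> 0" using of_nat_odd_neq_0[of "Suc n"] by (simp add: m_def add.commute)
  \<comment> \<open>All four binomial coefficients of the new terms are expressed through
    \<open>X\<close> and \<open>Y\<close>; what remains is an identity of rational functions in
    \<open>x\<close> and \<open>m\<close>.\<close>
  have a: "x gchoose Suc n = x / m * X"
    using gbinomial_absorption[of n x] m by (simp add: m_def X_def field_simps)
  have b: "(- x) gchoose Suc n = - x / m * Y"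
    using gbinomial_absorption[of n "- x"] m by (simp add: m_def Y_def field_simps)
  have c: "(x - 1) gchoose Suc n = X * (x - m) / m"
    unfolding gchoose_Suc X_def m_def by (simp add: algebra_simps)
  have d: "(- x - 1) gchoose Suc n = Y * (- x - m) / m"
    unfolding gchoose_Suc Y_def m_def by (simp add: algebra_simps)
  have t: "sum_term x (Suc n) = (x / m * X) * (Y * (- x - m) / m)"
    using a d by (simp only: sum_term_def minus_diff_commute[of 1 x])
  have t': "sum_term (x - 1) (Suc n) = (X * (x - m) / m) * (- x / m * Y)"
    using b c by (simp add: sum_term_def)
  have "(2 * x - 1) * sum_upto (Suc (Suc n)) x - (2 * x + 1) * sum_upto (Suc (Suc n)) (x - 1)
     = 2 * X * Y + ((2 * x - 1) * sum_term x (Suc n) - (2 * x + 1) * sum_term (x - 1) (Suc n)) / (2 * m - 1)"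
    using Suc.IH unfolding X_def Y_def sum_upto_def lessThan_Suc[of "Suc n"]
    by (simp add: m_def algebra_simps add_divide_distrib diff_divide_distrib)
  \<comment> \<open>The combination of the new terms contains the factor 2m - 1, which cancels their
    common weight 1 / (2m - 1).\<close>
  also have "((2 * x - 1) * sum_term x (Suc n) - (2 * x + 1) * sum_term (x - 1) (Suc n))
     = (2 * m - 1) * (- 2 * x\<^sup>2 * X * Y / m\<^sup>2)"
    unfolding t t' using m by (simp add: field_simps power2_eq_square)
  also have "2 * X * Y + (2 * m - 1) * (- 2 * x\<^sup>2 * X * Y / m\<^sup>2) / (2 * m - 1)
     = 2 * (X * (x - m) / m) * (Y * (- x - m) / m)"
    using m m2 by (simp add: field_simps power2_eq_square)
  finally show ?case by (simp only: c d)
qed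

text \<open>The recurrence divided by (2x - 1)(2x + 1). Writing 2x - 1 as 2(x - 1) + 1 makes the
  same quotient appear at x and at x - 1, ready for telescoping.\<close>

lemma sum_upto_step:
  assumes "2 * x - 1 \<noteq> 0" "2 * x + 1 \<noteq> 0" "n > 0"
  shows "sum_upto n x / (2 * x + 1) = sum_upto n (x - 1) / (2 * (x - 1) + 1)
    + 2 * (((x - 1) gchoose (n - 1)) * ((- x - 1) gchoose (n - 1))) / ((2 * x - 1) * (2 * x + 1))"
proof -
  have divide: "F / v = G / u + Z / (u * v)" if "u * F - v * G = Z" "u \<noteq> 0" "v \<noteq> 0"
    for F G Z u v :: rat
    using that by (auto simp: field_simps)
  have "2 * (x - 1) + 1 = 2 * x - 1" by simp
  with divide[OF sum_upto_recurrence[of x "n - 1"] assms(1,2)] assms(3) show ?thesis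
    by (simp add: mult.assoc)
qed

text \<open>Pairing the factors x - i and -x - i for i = 1, ..., k gives i^2 - x^2; left over are x
  and -(k + 1 + x). At x = pt this exhibits a factor p, and a product whose factors are close to
  1.\<close>

lemma sum_term_Suc:
  "sum_term x (Suc k) = - (x * (of_nat (Suc k) + x) / of_nat (Suc k) ^ 2)
     * (\<Prod>i=1..k. 1 - x\<^sup>2 / of_nat i ^ 2)"
proof (induction k)
  case 0
  then show ?case by (simp add: sum_term_def gchoose_Suc algebra_simps One_nat_def)
next
  case (Suc k)
  define m where "m = rat_of_nat (Suc k)"
  have m: "m \<noteq> 0" "m + 1 \<noteq> 0" unfolding m_def by (simp_all flip: of_nat_Suc)
  have "sum_term x (Suc (Suc k)) = sum_term x (Suc k) * ((x - m) * (- 1 - x - m) / (m + 1)\<^sup>2)"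
    unfolding sum_term_def gchoose_Suc[of _ "Suc k"] m_def
    by (simp add: power2_eq_square)
  also have "\<dots> = - (x * (m + 1 + x) / (m + 1)\<^sup>2)
      * ((\<Prod>i=1..k. 1 - x\<^sup>2 / of_nat i ^ 2) * (1 - x\<^sup>2 / m\<^sup>2))"
    unfolding Suc.IH m_def[symmetric] using m by (simp add: field_simps power2_eq_square)
  finally show ?case by (simp add: m_def add.commute)
qed

text \<open>The same pairing of x - i with -x - i, this time with nothing left over.\<close>

lemma gchoose_product:
  "((x - 1) gchoose n) * ((- x - 1) gchoose n) = (\<Prod>i=1..n. 1 - x\<^sup>2 / of_nat i ^ 2)"
  for x :: rat
proof (induction n)
  case (Suc n)
  define m where "m = rat_of_nat (Suc n)"
  have m: "m \<noteq> 0" by (simp add: m_def del: of_nat_Suc)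
  have "((x - 1) gchoose Suc n) * ((- x - 1) gchoose Suc n)
      = (((x - 1) gchoose n) * ((- x - 1) gchoose n)) * ((x - m) * (- x - m) / m\<^sup>2)"
    unfolding gchoose_Suc by (simp add: m_def power2_eq_square algebra_simps)
  also have "(x - m) * (- x - m) / m\<^sup>2 = 1 - x\<^sup>2 / m\<^sup>2"
    using m by (simp add: field_simps power2_eq_square)
  finally show ?case using Suc.IH by (simp add: m_def)
qed simp

section \<open>Congruences modulo powers of p\<close>

text \<open>The harmonic numbers of order two.\<close>

definition H2 :: "nat \<Rightarrow> rat" where
  "H2 n = (\<Sum>i=1..n. 1 / of_nat i ^ 2)"

lemma H2_Suc: "H2 (Suc n) = H2 n + 1 / of_nat (Suc n) ^ 2"
  by (simp add: H2_def)

context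
  fixes p :: nat
  assumes prime: "prime p" and p_gt_3: "p > 3"
begin

lemma p_ge_5: "p \<ge> 5"
proof -
  have "\<not> prime (2 * 2 :: nat)" using prime_product[of 2 2] by fastforce
  then have "p \<noteq> 4" using prime by auto
  then show ?thesis using p_gt_3 by simp
qed

lemma odd_p: "odd p"
  using prime p_gt_3 prime_odd_nat by simp

lemmas [simp] = Zp_of_int[OF prime] Zp_of_nat[OF prime] Zp_numeral[OF prime] Zp_0[OF prime]
  Zp_1[OF prime] Zp_add[OF prime] Zp_mult[OF prime] Zp_minus[OF prime] Zp_diff[OF prime]
  Zp_power[OF prime] qcong_refl[OF prime]

lemmas [trans] = qcong_trans[OF prime]

section \<open>Bernoulli polynomials modulo p and sums of inverse squares\<close>

lemma inverse_square_Zp: "0 < k \<Longrightarrow> k < p \<Longrightarrow> 1 / of_nat k ^ 2 \<in> Zp p"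
  using Zp_power[OF prime Zp_inverse_of_nat[OF prime, of k], of 2]
  by (simp add: power_inverse inverse_eq_divide power_one_over)

lemma H2_Zp: "n < p \<Longrightarrow> H2 n \<in> Zp p"
  unfolding H2_def by (intro Zp_sum[OF prime] inverse_square_Zp) auto

text \<open>The recurrence for index k = n + 1 divides only by n + 2 = k + 1, which the bound on k
  keeps below p.\<close>

lemma bernoulli_Zp: "k < p - 1 \<Longrightarrow> bernoulli k \<in> Zp p"
proof (induction k rule: less_induct)
  case (less k)
  show ?case
  proof (cases k)
    case (Suc n)
    have "inverse (of_nat (n + 2)) \<in> Zp p"
      using less.prems Suc by (intro Zp_inverse_of_nat[OF prime]) auto
    moreover have "(\<Sum>k\<le>n. of_nat ((n + 2) choose k) * bernoulli k) \<in> Zp p"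
      using less Suc by (intro Zp_sum[OF prime] Zp_mult[OF prime]) auto
    ultimately show ?thesis
      unfolding Suc bernoulli.simps divide_inverse by (intro Zp_mult[OF prime] Zp_minus[OF prime])
  qed simp
qed

lemma bernpoly_cong:
  assumes "n < p - 1" "qcong p 1 x y" "y \<in> Zp p"
  shows "qcong p 1 (bernpoly n x) (bernpoly n y)"
  unfolding bernpoly_def using assms bernoulli_Zp
  by (intro qcong_sum[OF prime] qcong_cmult[OF prime] qcong_power[OF prime]) auto

lemma fermat_inverse_square:
  assumes "0 < m" "m < p"
  shows "qcong p 1 (of_nat m ^ (p - 3)) (1 / of_nat m ^ 2)"
proof -
  have "[m ^ (p - 1) = 1] (mod p)"
    using assms prime by (intro fermat_theorem) (auto simp: nat_dvd_not_less)
  then have "[int (m ^ (p - 1)) = int 1] (mod int p)" by (simp only: cong_int_iff)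
  then have "qcong p 1 (of_int (int (m ^ (p - 1)))) (of_int (int 1))"
    by (simp only: qcong_of_int[OF prime])
  then have "qcong p 1 (of_nat m ^ (p - 1)) 1" by simp
  then have "qcong p 1 (1 / of_nat m ^ 2 * of_nat m ^ (p - 1)) (1 / of_nat m ^ 2 * 1)"
    using inverse_square_Zp assms by (intro qcong_cmult[OF prime])
  moreover have "p - 1 = 2 + (p - 3)" using p_gt_3 by simp
  ultimately show ?thesis using assms(1) by (simp add: power_add power2_eq_square)
qed

text \<open>As p - 2 is odd, reflection makes the values at 0 and 1 opposite; the difference
  equation makes them equal, because 0^(p - 3) = 0 for p > 3.\<close>

lemma bernpoly_0: "bernpoly (p - 2) 0 = 0"
  using bernpoly_reflect[of "p - 2" 0] bernpoly_add_one[of "p - 2" 0] odd_p p_gt_3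
  by (simp add: zero_power)

text \<open>Going down from 0, the step to -(r + 1) subtracts (p - 2)(r + 1)^(p - 3), the sign
  vanishing in the even power. By Fermat this is -2 / (r + 1)^2 modulo p.\<close>

lemma bernpoly_H2: "r < p \<Longrightarrow> qcong p 1 (bernpoly (p - 2) (- of_nat r)) (2 * H2 r)"
proof (induction r)
  case 0
  then show ?case by (simp add: bernpoly_0 H2_def)
next
  case (Suc r)
  let ?m = "rat_of_nat (Suc r)"
  have ev: "even (p - 3)" and p3: "p - 2 - 1 = p - 3" using odd_p p_gt_3 by auto
  have "bernpoly (p - 2) (- ?m) = bernpoly (p - 2) (- of_nat r) - of_nat (p - 2) * ?m ^ (p - 3)"
  proof -
    have "- ?m + 1 = - of_nat r" by simp
    then show ?thesis
      using bernpoly_add_one[of "p - 2" "- ?m"] unfolding p3 power_minus_even[OF ev]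
      by (simp only: diff_eq_eq add.commute eq_diff_eq)
  qed
  also have "qcong p 1 \<dots> (2 * H2 r - (- 2) * (1 / ?m ^ 2))"
  proof (intro qcong_diff[OF prime] qcong_mult[OF prime])
    have "rat_of_nat (p - 2) = of_nat p * 1 + (- 2)" using p_gt_3 by (simp add: of_nat_diff)
    then show "qcong p 1 (of_nat (p - 2)) (- 2)"
      using qcong_1_p_multiple[OF prime, of 1 "- 2"] by simp
  qed (use Suc fermat_inverse_square[of "Suc r"] in auto)
  also have "2 * H2 r - (- 2) * (1 / ?m ^ 2) = 2 * H2 (Suc r)" by (simp add: H2_Suc)
  finally show ?case .
qed

text \<open>Modulo p the argument -(p - 1) is 1, where the Bernoulli polynomial vanishes by
  reflection from 0.\<close>

lemma H2_all: "qcong p 1 (H2 (p - 1)) 0"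
proof -
  have "qcong p 1 (2 * H2 (p - 1)) (bernpoly (p - 2) (- of_nat (p - 1)))"
    using bernpoly_H2[of "p - 1"] p_gt_3 qcong_sym[OF prime] by simp
  also have "qcong p 1 \<dots> (bernpoly (p - 2) 1)"
    using p_gt_3 qcong_1_p_multiple[OF prime, of "- 1" 1]
    by (intro bernpoly_cong) (auto simp: of_nat_diff)
  also have "bernpoly (p - 2) 1 = 0"
    using bernpoly_reflect[of "p - 2" 0] bernpoly_0 by simp
  finally have "qcong p 1 (inverse 2 * (2 * H2 (p - 1))) (inverse 2 * 0)"
    using Zp_inverse_of_nat[OF prime, of 2] p_gt_3 by (intro qcong_cmult[OF prime]) auto
  then show ?thesis by simp
qed

text \<open>For p = 2h + 1 the point -h is fixed modulo p by the reflection x -> 1 - x, under which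
  the polynomial of odd index p - 2 changes sign. Its value there is therefore 0 modulo p.\<close>

lemma H2_half:
  assumes "2 * h + 1 = p" shows "qcong p 1 (H2 h) 0"
proof -
  let ?B = "bernpoly (p - 2)"
  have ph: "1 - (- rat_of_nat h) = of_nat p * 1 + - of_nat h"
    unfolding assms[symmetric] by simp
  have "odd (p - 2)" using odd_p p_gt_3 by simp
  then have "?B (- of_nat h) = - ?B (1 - (- of_nat h))"
    using bernpoly_reflect[of "p - 2" "- of_nat h"] by simp
  also have "qcong p 1 \<dots> (- ?B (- of_nat h))"
  proof (intro qcong_minus[OF prime] bernpoly_cong)
    show "qcong p 1 (1 - (- of_nat h)) (- of_nat h)"
      unfolding ph by (intro qcong_1_p_multiple[OF prime]) auto
  qed (use p_gt_3 in auto)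
  finally have "qcong p 1 (?B (- of_nat h) + ?B (- of_nat h)) (- ?B (- of_nat h) + ?B (- of_nat h))"
    using qcong_add[OF prime] qcong_refl[OF prime] by blast
  then have *: "qcong p 1 (2 * ?B (- of_nat h)) 0"
    by (simp only: mult_2 add.left_inverse)
  have "qcong p 1 (2 * (2 * H2 h)) (2 * ?B (- of_nat h))"
    using assms by (intro qcong_cmult[OF prime] qcong_sym[OF prime bernpoly_H2]) auto
  also note *
  finally have "qcong p 1 (inverse 4 * (2 * (2 * H2 h))) (inverse 4 * 0)"
    using Zp_inverse_of_nat[OF prime, of 4] p_ge_5 by (intro qcong_cmult[OF prime]) auto
  then show ?thesis by simp
qed

section \<open>Products and binomial coefficients modulo powers of p\<close>

lemma prod_one_minus_cong:
  assumes "finite A" "\<And>i. i \<in> A \<Longrightarrow> u i \<in> Zp p"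
  shows "qcong p 3 (\<Prod>i\<in>A. 1 - of_nat p ^ 2 * u i) (1 - of_nat p ^ 2 * (\<Sum>i\<in>A. u i))"
  using assms
proof (induction A rule: finite_induct)
  case (insert j A)
  let ?p = "rat_of_nat p"
  let ?S = "\<Sum>i\<in>A. u i"
  have u: "u j \<in> Zp p" and S: "?S \<in> Zp p" using insert by (auto intro: Zp_sum[OF prime])
  have "qcong p 3 ((1 - ?p ^ 2 * u j) * (\<Prod>i\<in>A. 1 - ?p ^ 2 * u i)) ((1 - ?p ^ 2 * u j) * (1 - ?p ^ 2 * ?S))"
    using insert u by (intro qcong_cmult[OF prime]) auto
  \<comment> \<open>The cross term carries p^4 and drops out.\<close>
  also have "(1 - ?p ^ 2 * u j) * (1 - ?p ^ 2 * ?S) = ?p ^ 3 * (?p * u j * ?S) + (1 - ?p ^ 2 * (u j + ?S))"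
    by (simp add: algebra_simps power2_eq_square power3_eq_cube)
  also have "qcong p 3 \<dots> (0 + (1 - ?p ^ 2 * (u j + ?S)))"
    using u S by (intro qcong_add[OF prime] qcong_p_0[OF prime]) auto
  finally show ?case using insert by simp
qed simp

lemma prod_one_minus_square_cong:
  assumes "t \<in> Zp p" "n < p"
  shows "qcong p 3 (\<Prod>i=1..n. 1 - (of_nat p * t)\<^sup>2 / of_nat i ^ 2) (1 - of_nat p ^ 2 * (t\<^sup>2 * H2 n))"
proof -
  have *: "(of_nat p * t)\<^sup>2 / of_nat i ^ 2 = of_nat p ^ 2 * (t\<^sup>2 * (1 / of_nat i ^ 2))" for i
    by (simp add: power_mult_distrib)
  show ?thesis
    unfolding * H2_def sum_distrib_left[of "t\<^sup>2"]
    using assms by (intro prod_one_minus_cong Zp_mult[OF prime] inverse_square_Zp) auto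
qed

text \<open>Modulo p the upper argument is -1, and binom(-1, k) = (-1)^k; for k < p all denominators
  are units.\<close>

lemma gchoose_p_multiple_minus_1:
  assumes "t \<in> Zp p"
  shows "k < p \<Longrightarrow> qcong p 1 ((of_nat p * t - 1) gchoose k) ((- 1) ^ k)"
proof (induction k)
  case (Suc k)
  let ?x = "of_nat p * t - 1" and ?m = "rat_of_nat (Suc k)"
  have c: "qcong p 1 (of_nat p * t + - ?m) (- ?m)"
    using assms by (rule qcong_1_p_multiple[OF prime])
  have i: "inverse ?m \<in> Zp p" using Suc.prems by (intro Zp_inverse_of_nat[OF prime]) auto
  have "?x gchoose Suc k = (?x gchoose k) * ((of_nat p * t + - ?m) * inverse ?m)"
    unfolding gchoose_Suc by (simp add: field_simps)
  also have "qcong p 1 \<dots> ((- 1) ^ k * (- ?m * inverse ?m))"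
    using Suc i assms
    by (intro qcong_mult[OF prime] c Zp_mult[OF prime] Zp_add[OF prime] Zp_minus[OF prime]) auto
  also have "(- 1) ^ k * (- ?m * inverse ?m) = (- 1) ^ Suc k"
    by (simp del: of_nat_Suc)
  finally show ?case .
qed simp

lemma qcong_not_0_of_nat: "0 < k \<Longrightarrow> k < p \<Longrightarrow> \<not> qcong p 1 (of_nat k) 0"
  using qcong_of_int_iff[OF prime, of "int k"] by (simp add: nat_dvd_not_less)

lemma p_multiple_plus_unit:
  assumes "z \<in> Zp p" "0 < k" "k < p"
  shows "inverse (of_nat p * z + of_nat k) \<in> Zp p"
    and "qcong p 1 (inverse (of_nat p * z + of_nat k)) (inverse (of_nat k))"
    and "of_nat p * z + of_nat k \<noteq> 0"
proof -
  have c: "qcong p 1 (of_nat p * z + of_nat k) (of_nat k)"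
    using assms(1) by (rule qcong_1_p_multiple[OF prime])
  then show "inverse (of_nat p * z + of_nat k) \<in> Zp p"
    "qcong p 1 (inverse (of_nat p * z + of_nat k)) (inverse (of_nat k))"
    using inverse_of_qcong[OF prime c] qcong_not_0_of_nat assms by auto
  show "of_nat p * z + of_nat k \<noteq> 0"
    using c qcong_not_0_of_nat[OF assms(2,3)] qcong_sym[OF prime] by metis
qed

text \<open>Of the p - 1 consecutive factors in the numerator, exactly one, namely pt, is 0 modulo
  p. It is split off explicitly, so that its cofactor \<open>u\<close> need only be known modulo
  p.\<close>

lemma gchoose_p_minus_1_cong:
  assumes "t \<in> Zp p" "0 < j" "j < p"
  shows "\<exists>u\<in>Zp p. (of_nat p * t + of_nat j - 1) gchoose (p - 1) = of_nat p * t * u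
    \<and> qcong p 1 u (1 / of_nat j)"
proof -
  have "t - 1 \<in> Zp p" using assms(1) by simp
  note unit = p_multiple_plus_unit[OF this]
  \<comment> \<open>Absorption raises the upper argument by one. The divisor pt + k - (p - 1) equals
    p(t - 1) + (k + 1), a unit.\<close>
  have rec: "(of_nat p * t + of_nat k) gchoose (p - 1) =
      (of_nat p * t + of_nat k) * ((of_nat p * t + of_nat k - 1) gchoose (p - 1))
        * inverse (of_nat p * (t - 1) + of_nat (Suc k))" if "Suc k < p" for k
  proof -
    have "of_nat p * t + of_nat k - of_nat (p - 1) = of_nat p * (t - 1) + of_nat (Suc k)"
      using p_gt_3 by (simp add: of_nat_diff algebra_simps)
    with gbinomial_absorb_comp[of "of_nat p * t + of_nat k" "p - 1"]
    have "(of_nat p * (t - 1) + of_nat (Suc k)) * ((of_nat p * t + of_nat k) gchoose (p - 1))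
      = (of_nat p * t + of_nat k) * ((of_nat p * t + of_nat k - 1) gchoose (p - 1))" by metis
    note eq = this
    have "A = Y * inverse D" if "D * A = Y" "D \<noteq> 0" for A D Y :: rat
      using that by auto
    from this[OF eq unit(3)[OF zero_less_Suc that]] show ?thesis .
  qed
  have "\<exists>u\<in>Zp p. (of_nat p * t + of_nat k) gchoose (p - 1) = of_nat p * t * u
    \<and> qcong p 1 u (inverse (of_nat (Suc k)))" if "Suc k < p" for k
    using that
  proof (induction k)
    case 0
    \<comment> \<open>In the step with k = 0 the multiplier pt + k is pt itself: this is where the
      split-off factor enters. As p - 1 is even, \<open>?A\<close> is 1 modulo p.\<close>
    let ?A = "(of_nat p * t - 1) gchoose (p - 1)"
    let ?v = "inverse (of_nat p * (t - 1) + of_nat (Suc 0))"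
    have A: "qcong p 1 ?A 1"
      using gchoose_p_multiple_minus_1[of t "p - 1"] assms odd_p p_gt_3 by simp
    have "?A * ?v \<in> Zp p" using unit[OF _ 0] qcong_mem[OF prime A] by simp
    moreover have "qcong p 1 (?A * ?v) (1 * inverse (of_nat (Suc 0)))"
      using unit[OF _ 0] A by (intro qcong_mult[OF prime]) auto
    ultimately show ?case using rec[OF 0]
      by (intro bexI[of _ "?A * ?v"]) (simp_all add: mult.assoc)
  next
    case (Suc k)
    then obtain u where u: "u \<in> Zp p" "(of_nat p * t + of_nat k) gchoose (p - 1) = of_nat p * t * u"
      "qcong p 1 u (inverse (of_nat (Suc k)))" by auto
    let ?v = "inverse (of_nat p * (t - 1) + of_nat (Suc (Suc k)))"
    let ?u = "(of_nat p * t + of_nat (Suc k)) * (u * ?v)"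
    have e: "of_nat p * t + of_nat (Suc k) - 1 = of_nat p * t + of_nat k" by simp
    have c: "qcong p 1 (of_nat p * t + of_nat (Suc k)) (of_nat (Suc k))"
      using assms(1) by (rule qcong_1_p_multiple[OF prime])
    have v: "?v \<in> Zp p" "qcong p 1 ?v (inverse (of_nat (Suc (Suc k))))"
      using unit[OF _ Suc.prems] by auto
    have "inverse (rat_of_nat (Suc k)) \<in> Zp p"
      using Suc.prems by (intro Zp_inverse_of_nat[OF prime]) auto
    from qcong_mult[OF prime c qcong_mult[OF prime u(3) v(2) v(1) this] Zp_mult[OF prime u(1) v(1)]]
    have "qcong p 1 ?u (inverse (of_nat (Suc (Suc k))))"
      by (simp add: mult.assoc[symmetric] del: of_nat_Suc)
    moreover have "?u \<in> Zp p" using u(1) v(1) qcong_mem[OF prime c] by simp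
    moreover have "(of_nat p * t + of_nat (Suc k)) gchoose (p - 1) = of_nat p * t * ?u"
      using rec[OF Suc.prems] unfolding e u(2) by (simp only: mult_ac)
    ultimately show ?case by (intro bexI[of _ ?u] conjI)
  qed
  from this[of "j - 1"] show ?thesis
    using assms by (simp add: of_nat_diff inverse_eq_divide add_diff_eq)
qed

lemma gchoose_product_cong:
  assumes "t \<in> Zp p" "0 < j" "j < p"
  defines "x \<equiv> of_nat p * t + of_nat j"
  shows "qcong p 3 (((x - 1) gchoose (p - 1)) * ((- x - 1) gchoose (p - 1)))
    (of_nat p ^ 2 * (t * (t + 1) * (1 / of_nat j ^ 2)))"
proof -
  let ?p = "rat_of_nat p" and ?j = "rat_of_nat j"
  obtain u where u: "u \<in> Zp p" "(x - 1) gchoose (p - 1) = ?p * t * u" "qcong p 1 u (1 / ?j)"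
    using gchoose_p_minus_1_cong[OF assms(1-3)] by (auto simp: x_def)
  have "- t - 1 \<in> Zp p" "0 < p - j" "p - j < p" using assms by auto
  \<comment> \<open>The second binomial coefficient is of the same shape, with -t - 1 for t and p -
    j for j.\<close>
  moreover have "?p * (- t - 1) + of_nat (p - j) - 1 = - x - 1"
    using assms by (simp add: x_def of_nat_diff algebra_simps)
  ultimately obtain v where v: "v \<in> Zp p" "(- x - 1) gchoose (p - 1) = ?p * (- t - 1) * v"
    "qcong p 1 v (1 / of_nat (p - j))"
    using gchoose_p_minus_1_cong by metis
  have ij: "1 / ?j \<in> Zp p" using Zp_inverse_of_nat[OF prime] assms by (simp add: inverse_eq_divide)
  have "qcong p 1 (?p * 1 + - ?j) (- ?j)" by (intro qcong_1_p_multiple[OF prime]) auto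
  moreover have "\<not> qcong p 1 (- ?j) 0"
    using qcong_not_0_of_nat[OF assms(2,3)] qcong_minus[OF prime, of 1 "- ?j" 0] by auto
  ultimately have "qcong p 1 (inverse (?p * 1 + - ?j)) (inverse (- ?j))"
    by (intro inverse_of_qcong[OF prime]) auto
  then have "qcong p 1 (1 / of_nat (p - j)) (- (1 / ?j))"
    using assms by (simp add: of_nat_diff inverse_eq_divide)
  with v have v': "qcong p 1 v (- (1 / ?j))" using qcong_trans[OF prime] by blast
  have "((x - 1) gchoose (p - 1)) * ((- x - 1) gchoose (p - 1)) = ?p ^ 2 * (t * (- t - 1) * (u * v))"
    unfolding u(2) v(2) by (simp add: power2_eq_square)
  also have "qcong p (2 + 1) \<dots> (?p ^ 2 * (t * (- t - 1) * (1 / ?j * - (1 / ?j))))"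
    using assms(1) u v v' ij
    by (intro qcong_scale[OF prime] qcong_cmult[OF prime] qcong_mult[OF prime]) auto
  also have "t * (- t - 1) * (1 / ?j * - (1 / ?j)) = t * (t + 1) * (1 / ?j ^ 2)"
  proof -
    have "t * (- t - 1) * (i * - i) = t * (t + 1) * (i * i)" for i :: rat
      by (simp add: algebra_simps)
    from this[of "1 / ?j"] show ?thesis by (simp add: power2_eq_square)
  qed
  finally show ?thesis by simp
qed

section \<open>Arguments divisible by p\<close>

lemma qcong_scale_3: "qcong p 1 x y \<Longrightarrow> qcong p 3 (of_nat p ^ 2 * x) (of_nat p ^ 2 * y)"
  using qcong_scale[OF prime, of 1 x y 2] by simp

text \<open>By \<open>sum_term_Suc\<close> the term is a quadratic polynomial in t times a product
  \<open>Q\<close> that is 1 modulo p^2. The claim amounts to replacing \<open>Q\<close> by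
  1.\<close>

lemma sum_term_p_multiple_cong:
  assumes t: "t \<in> Zp p" and k: "0 < k" "k < p"
  shows "qcong p 3 (sum_term (of_nat p * t) k * (1 / (2 * of_nat k - 1)))
    (- (of_nat p / (of_nat k * (2 * of_nat k - 1))) * t
      - of_nat p ^ 2 / (of_nat k ^ 2 * (2 * of_nat k - 1)) * t\<^sup>2)"
proof -
  let ?p = "rat_of_nat p" and ?k = "rat_of_nat k"
  define Q where "Q = (\<Prod>i=1..k - 1. 1 - (?p * t)\<^sup>2 / of_nat i ^ 2)"
  have Q: "qcong p 3 Q (1 - ?p ^ 2 * (t\<^sup>2 * H2 (k - 1)))"
    unfolding Q_def using t k by (intro prod_one_minus_square_cong) auto
  then obtain w where w: "w \<in> Zp p" "Q = 1 - ?p ^ 2 * (t\<^sup>2 * H2 (k - 1)) + ?p ^ 3 * w"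
    by (auto simp: qcong_iff[OF prime])
  have H: "H2 (k - 1) \<in> Zp p" using k by (intro H2_Zp) simp
  text \<open>The denominator \<^term>\<open>2 * k - 1\<close> is divisible by p only for k = (p + 1) / 2, where the
    vanishing of \<^term>\<open>H2 (k - 1)\<close> modulo p makes up for it.\<close>
  have "\<exists>z\<in>Zp p. (Q - 1) * (?p / (2 * ?k - 1)) = ?p ^ 3 * z"
  proof (cases "2 * k - 1 = p")
    case True
    then have "2 * (k - 1) + 1 = p" using k by simp
    then obtain v where v: "v \<in> Zp p" "H2 (k - 1) = ?p * v"
      using H2_half qcong_0_iff[OF prime, of 1] by auto
    have "2 * ?k - 1 = ?p" unfolding True[symmetric] using k by (simp add: of_nat_diff)
    then have "(Q - 1) * (?p / (2 * ?k - 1)) = ?p ^ 3 * (w - t\<^sup>2 * v)"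
      using p_nonzero[OF prime] w v by (simp add: algebra_simps power2_eq_square power3_eq_cube)
    then show ?thesis using w v t by (intro bexI[of _ "w - t\<^sup>2 * v"]) auto
  next
    case False
    \<comment> \<open>Since 0 < 2k - 1 < 2p, the only multiple of p it could be is p itself.\<close>
    have "\<not> p dvd 2 * k - 1"
    proof
      assume "p dvd 2 * k - 1"
      then obtain c where c: "2 * k - 1 = p * c" by blast
      have "c \<noteq> 0" using c k by (intro notI) simp
      moreover have "c < 2"
      proof (rule ccontr)
        assume "\<not> c < 2"
        then have "p * 2 \<le> p * c" by simp
        then show False using c k by linarith
      qed
      ultimately have "c = 1" by simp
      then show False using False c by simp
    qed
    then have "\<not> int p dvd int (2 * k - 1)" by simp
    from Zp_inverse_of_int[OF prime this]
    have i: "inverse (2 * ?k - 1) \<in> Zp p" using k by (simp add: of_nat_diff)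
    have "(Q - 1) * (?p / (2 * ?k - 1)) = ?p ^ 3 * ((?p * w - t\<^sup>2 * H2 (k - 1)) * inverse (2 * ?k - 1))"
      unfolding w(2) divide_inverse by (simp add: algebra_simps power2_eq_square power3_eq_cube)
    then show ?thesis using w H t i
      by (intro bexI[of _ "(?p * w - t\<^sup>2 * H2 (k - 1)) * inverse (2 * ?k - 1)"]) auto
  qed
  then obtain z where z: "z \<in> Zp p" "(Q - 1) * (?p / (2 * ?k - 1)) = ?p ^ 3 * z" by blast
  have k0: "?k \<noteq> 0" and k1: "2 * ?k - 1 \<noteq> 0" using k of_nat_odd_neq_0 by auto
  define C where "C = t * (?k + ?p * t) * (1 / ?k ^ 2)"
  define D where "D = ?p / (2 * ?k - 1)"
  have CD: "C * D = ?p / (?k * (2 * ?k - 1)) * t + ?p ^ 2 / (?k ^ 2 * (2 * ?k - 1)) * t\<^sup>2"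
    using k0 k1 by (simp add: C_def D_def add_divide_distrib distrib_left distrib_right power2_eq_square mult_ac)
  have "sum_term (?p * t) k = - (?p * t * (?k + ?p * t) / ?k ^ 2) * Q"
    using sum_term_Suc[of "?p * t" "k - 1"] k by (simp add: Q_def)
  then have "sum_term (?p * t) k * (1 / (2 * ?k - 1)) = - (C * D) * Q"
    by (simp add: C_def D_def)
  \<comment> \<open>The first summand is the claimed quadratic, the second a multiple of
    p^3.\<close>
  also have "\<dots> = - (C * D) + - C * ((Q - 1) * D)"
    by (simp add: algebra_simps)
  also have "- (C * D) = - (?p / (?k * (2 * ?k - 1))) * t - ?p ^ 2 / (?k ^ 2 * (2 * ?k - 1)) * t\<^sup>2"
    unfolding CD by simp
  also have "- C * ((Q - 1) * D) = ?p ^ 3 * (- C * z)"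
    unfolding D_def z(2) by (simp only: mult_ac)
  finally have "sum_term (?p * t) k * (1 / (2 * ?k - 1))
    = (- (?p / (?k * (2 * ?k - 1))) * t - ?p ^ 2 / (?k ^ 2 * (2 * ?k - 1)) * t\<^sup>2) + ?p ^ 3 * (- C * z)" .
  moreover have "C \<in> Zp p"
    unfolding C_def using t k by (intro Zp_mult[OF prime] inverse_square_Zp) auto
  then have "- C * z \<in> Zp p" using z(1) by simp
  ultimately show ?thesis
    unfolding qcong_iff[OF prime] by (intro bexI)
qed

text \<open>Summing the termwise congruences gives coefficients independent of t; they stay
  unevaluated, to be determined by interpolation. The constant -1 is the term k = 0, whose weight is
  1 / (0 - 1).\<close>

lemma sum_upto_p_multiple_quadratic:
  obtains c d where "\<And>t. t \<in> Zp p \<Longrightarrow> qcong p 3 (sum_upto p (of_nat p * t)) (- 1 + c * t + d * t\<^sup>2)"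
proof -
  let ?c = "\<lambda>k. - (of_nat p / (of_nat k * (2 * of_nat k - 1))) :: rat"
  let ?d = "\<lambda>k. - (of_nat p ^ 2 / (of_nat k ^ 2 * (2 * of_nat k - 1))) :: rat"
  have *: "qcong p 3 (sum_upto p (of_nat p * t)) (- 1 + (\<Sum>k=1..<p. ?c k) * t + (\<Sum>k=1..<p. ?d k) * t\<^sup>2)"
    if "t \<in> Zp p" for t
  proof -
    have s0: "sum_term x 0 = 1" for x by (simp add: sum_term_def)
    have range: "{..<p} = insert 0 {1..<p}" using p_gt_3 by auto
    have expand: "sum_upto p (of_nat p * t)
        = - 1 + (\<Sum>k=1..<p. sum_term (of_nat p * t) k * (1 / (2 * of_nat k - 1)))"
      unfolding sum_upto_def range by (subst sum.insert) (simp_all add: s0)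
    have "qcong p 3 (sum_upto p (of_nat p * t)) (- 1 + (\<Sum>k=1..<p. ?c k * t + ?d k * t\<^sup>2))"
      unfolding expand
    proof (intro qcong_add[OF prime] qcong_sum[OF prime] qcong_refl[OF prime])
      fix k assume "k \<in> {1..<p}"
      then have k: "0 < k" "k < p" by auto
      show "qcong p 3 (sum_term (of_nat p * t) k * (1 / (2 * of_nat k - 1))) (?c k * t + ?d k * t\<^sup>2)"
        using sum_term_p_multiple_cong[OF that k]
        by (simp only: diff_conv_add_uminus mult_minus_left)
    qed
    then show ?thesis
      by (simp only: sum.distrib sum_distrib_right add.assoc)
  qed
  show ?thesis by (rule that, rule *)
qed

section \<open>Values at integers and interpolation\<close>

lemma sum_upto_p_of_nat: "r < p \<Longrightarrow> sum_upto p (of_nat r) = - (2 * of_nat r + 1)"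
proof (induction r)
  case 0
  have "sum_term 0 k = 0" if "k \<noteq> 0" for k
    using that sum_term_Suc[of 0 "k - 1"] by simp
  then have "sum_upto p 0 = (\<Sum>k<p. if k = 0 then - 1 else 0)"
    unfolding sum_upto_def by (intro sum.cong) (auto simp: sum_term_def)
  then show ?case using p_gt_3 by simp
next
  case (Suc r)
  \<comment> \<open>For r < p - 1 the extra term of the recurrence vanishes, so the quotient by 2x +
    1 keeps its value -1 from x = 0 onwards, exactly and not only modulo p^3.\<close>
  have "rat_of_nat r gchoose (p - 1) = 0"
    using Suc.prems by (simp flip: binomial_gbinomial add: binomial_eq_0)
  moreover have "2 * rat_of_nat (Suc r) - 1 \<noteq> 0" "2 * rat_of_nat (Suc r) + 1 \<noteq> 0"
    using of_nat_odd_neq_0 of_nat_odd_neq_0[of "Suc (Suc r)"] by auto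
  moreover have "2 * rat_of_nat r + 1 \<noteq> 0"
    using of_nat_odd_neq_0[of "Suc r"] by auto
  then have "- (2 * rat_of_nat r + 1) / (2 * rat_of_nat r + 1) = - 1" by (metis divide_self minus_divide_left)
  ultimately have "sum_upto p (of_nat (Suc r)) / (2 * of_nat (Suc r) + 1) = - 1"
    using sum_upto_step[of "of_nat (Suc r)" p] Suc p_gt_3 by simp
  then show ?case using \<open>2 * rat_of_nat (Suc r) + 1 \<noteq> 0\<close> by (simp add: field_simps)
qed

text \<open>One recurrence step from the exact value at p - 1. The product in its extra term is 1
  modulo p^3, because \<open>H2 (p - 1)\<close> vanishes modulo p.\<close>

lemma sum_upto_p_p:
  "qcong p 3 (sum_upto p (of_nat p)) (- 3 - 6 * of_nat p - 8 * of_nat p ^ 2)"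
proof -
  let ?p = "rat_of_nat p"
  define P where "P = ((?p - 1) gchoose (p - 1)) * ((- ?p - 1) gchoose (p - 1))"
  have nz: "2 * ?p - 1 \<noteq> 0" "2 * ?p + 1 \<noteq> 0"
    using of_nat_odd_neq_0[of p] of_nat_odd_neq_0[of "Suc p"] by auto
  have "qcong p 3 P (1 - ?p ^ 2 * (1\<^sup>2 * H2 (p - 1)))"
    unfolding P_def gchoose_product
    using prod_one_minus_square_cong[of 1 "p - 1"] p_gt_3 by simp
  also have "qcong p 3 (1 - ?p ^ 2 * (1\<^sup>2 * H2 (p - 1))) (1 - ?p ^ 2 * 0)"
    using H2_all by (intro qcong_diff[OF prime] qcong_scale_3) auto
  finally obtain w where w: "w \<in> Zp p" "P = 1 + ?p ^ 3 * w"
    by (auto simp: qcong_iff[OF prime])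
  have "\<not> int p dvd 2 * int p - 1"
    using p_gt_3 by (auto simp: zdvd_not_zless dvd_diff_right_iff)
  from Zp_inverse_of_int[OF prime this] have i: "inverse (2 * ?p - 1) \<in> Zp p" by simp
  have "sum_upto p ?p / (2 * ?p + 1)
      = sum_upto p (?p - 1) / (2 * (?p - 1) + 1) + 2 * P / ((2 * ?p - 1) * (2 * ?p + 1))"
    using sum_upto_step[OF nz, of p] p_gt_3 by (simp add: P_def)
  also have "sum_upto p (?p - 1) = - (2 * (?p - 1) + 1)"
    using sum_upto_p_of_nat[of "p - 1"] p_gt_3 by (simp add: of_nat_diff)
  also have "- (2 * (?p - 1) + 1) / (2 * (?p - 1) + 1) = - 1"
  proof -
    have "2 * (?p - 1) + 1 \<noteq> 0" using nz(1) by simp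
    then show ?thesis by (metis divide_self minus_divide_left)
  qed
  finally have quotient: "sum_upto p ?p / (2 * ?p + 1) = - 1 + 2 * P / ((2 * ?p - 1) * (2 * ?p + 1))" .
  have "F = - v + Z * inverse m" if "F / v = - 1 + Z / (m * v)" "v \<noteq> 0" for F Z v m :: rat
  proof -
    have "F = v * (F / v)" using that(2) by simp
    also have "\<dots> = - v + Z / m"
      unfolding that(1) using that(2) by (simp add: right_diff_distrib)
    finally show ?thesis by (simp only: divide_inverse)
  qed
  from this[OF quotient nz(2)]
  have "sum_upto p ?p = - (2 * ?p + 1) + 2 * P * inverse (2 * ?p - 1)" .
  \<comment> \<open>Geometric expansion: 2 / (2p - 1) = -2 - 4p - 8p^2 + 16p^3 / (2p - 1). The part
    2w of the error comes from \<open>P\<close>.\<close>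
  also have "\<dots> = - 3 - 6 * ?p - 8 * ?p ^ 2 + ?p ^ 3 * ((16 + 2 * w) * inverse (2 * ?p - 1))"
    unfolding w(2) using nz by (simp add: field_simps power2_eq_square power3_eq_cube)
  finally show ?thesis
    unfolding qcong_iff[OF prime] using w i
    by (intro bexI[of _ "(16 + 2 * w) * inverse (2 * ?p - 1)"]) auto
qed

text \<open>The quadratic is pinned down by its values at 0, 1 and -1. The two congruences at 1 and
  -1 are multiplied only by interpolation factors that are p-integral, as 2 is a unit.\<close>

lemma sum_upto_p_multiple:
  assumes "t \<in> Zp p"
  shows "qcong p 3 (sum_upto p (of_nat p * t))
    (- (2 * t + 1) * (1 + 2 * of_nat p * t) - 4 * of_nat p ^ 2 * t * (t + 1))"
proof -
  let ?p = "rat_of_nat p"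
  obtain c d where cd: "\<And>t. t \<in> Zp p \<Longrightarrow> qcong p 3 (sum_upto p (?p * t)) (- 1 + c * t + d * t\<^sup>2)"
    by (rule sum_upto_p_multiple_quadratic) blast
  have "qcong p 3 (sum_upto p ?p) (- 1 + c + d)"
    using cd[of 1] by simp
  then have one: "qcong p 3 (- 1 + c + d) (- 3 - 6 * ?p - 8 * ?p ^ 2)"
    using sum_upto_p_p qcong_sym[OF prime] qcong_trans[OF prime] by blast
  have "sum_upto p (- ?p) = sum_upto p (?p - 1)"
    using sum_upto_reflect[of p "?p - 1"] by simp
  also have "\<dots> = 1 - 2 * ?p"
    using sum_upto_p_of_nat[of "p - 1"] p_gt_3 by (simp add: of_nat_diff)
  finally have neg: "qcong p 3 (- 1 - c + d) (1 - 2 * ?p)"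
    using cd[of "- 1"] qcong_sym[OF prime] by simp
  have i2: "inverse 2 \<in> Zp p"
    using Zp_inverse_of_nat[OF prime, of 2] p_gt_3 by simp
  text \<open>Lagrange interpolation at 0, 1 and -1.\<close>
  define I where "I = (\<lambda>u v. - (1 - t\<^sup>2) + inverse 2 * (t\<^sup>2 + t) * u + inverse 2 * (t\<^sup>2 - t) * v)"
  have "- 1 + c * t + d * t\<^sup>2 = I (- 1 + c + d) (- 1 - c + d)"
    by (simp add: I_def field_simps power2_eq_square)
  also have "qcong p 3 \<dots> (I (- 3 - 6 * ?p - 8 * ?p ^ 2) (1 - 2 * ?p))"
    unfolding I_def using assms one neg
    by (intro qcong_add[OF prime] qcong_cmult[OF prime] Zp_mult[OF prime] i2) auto
  also have "I (- 3 - 6 * ?p - 8 * ?p ^ 2) (1 - 2 * ?p)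
      = - (2 * t + 1) * (1 + 2 * ?p * t) - 4 * ?p ^ 2 * t * (t + 1)"
    by (simp add: I_def field_simps power2_eq_square)
  finally show ?thesis using cd[OF assms] qcong_trans[OF prime] by blast
qed

section \<open>General arguments\<close>

text \<open>Telescoping from pt upwards. The bound 2r + 1 < p keeps all odd denominators met on the
  way prime to p.\<close>

lemma sum_upto_quotient:
  assumes t: "t \<in> Zp p"
  shows "2 * r + 1 < p \<Longrightarrow>
    qcong p 3 (sum_upto p (of_nat p * t + of_nat r) / (2 * (of_nat p * t + of_nat r) + 1))
      (- (2 * t + 1) - of_nat p ^ 2 * (t * (t + 1) * (4 * inverse (of_nat (2 * r + 1)) + 2 * H2 r)))"
proof (induction r)
  case 0
  let ?p = "rat_of_nat p"
  define v where "v = inverse (?p * (2 * t) + of_nat 1)"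
  have v: "v \<in> Zp p" "qcong p 1 v 1" "2 * (?p * t) + 1 \<noteq> 0"
    using p_multiple_plus_unit[of "2 * t" 1] t p_gt_3 by (auto simp: v_def mult.left_commute)
  have vi: "v = inverse (2 * (?p * t) + 1)" by (simp add: v_def mult.left_commute)
  have "sum_upto p (?p * t) / (2 * (?p * t) + 1) = v * sum_upto p (?p * t)"
    by (simp add: vi divide_inverse)
  also have "qcong p 3 \<dots> (v * (- (2 * t + 1) * (1 + 2 * ?p * t) - 4 * ?p ^ 2 * t * (t + 1)))"
    by (intro qcong_cmult[OF prime] sum_upto_p_multiple t v)
  also have "\<dots> = - (2 * t + 1) * (v * (2 * (?p * t) + 1)) - ?p ^ 2 * (4 * t * (t + 1) * v)"
    by (simp add: algebra_simps)
  \<comment> \<open>The factor 1 + 2pt in the value at pt cancels exactly; behind p^2 only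
    \<open>v\<close> modulo p matters, and that is 1.\<close>
  also have "v * (2 * (?p * t) + 1) = 1" using v(3) by (simp add: vi)
  also have "qcong p 3 (- (2 * t + 1) * 1 - ?p ^ 2 * (4 * t * (t + 1) * v))
      (- (2 * t + 1) * 1 - ?p ^ 2 * (4 * t * (t + 1) * 1))"
    using t v by (intro qcong_diff[OF prime] qcong_scale_3 qcong_cmult[OF prime]) auto
  finally show ?case by (simp add: H2_def mult_ac)
next
  case (Suc r)
  let ?p = "rat_of_nat p"
  define j where "j = Suc r"
  have j: "0 < j" "j < p" "2 * j + 1 < p" "2 * j - 1 < p" "0 < 2 * j - 1" using Suc.prems by (auto simp: j_def)
  define x where "x = ?p * t + of_nat j"
  have x1: "x - 1 = ?p * t + of_nat r" by (simp add: x_def j_def)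
  have e: "2 * x - 1 = ?p * (2 * t) + of_nat (2 * j - 1)" "2 * x + 1 = ?p * (2 * t) + of_nat (2 * j + 1)"
    using j by (simp_all add: x_def of_nat_diff algebra_simps)
  define u where "u = inverse (2 * x - 1)"
  define v where "v = inverse (2 * x + 1)"
  define u0 where "u0 = inverse (rat_of_nat (2 * j - 1))"
  define v0 where "v0 = inverse (rat_of_nat (2 * j + 1))"
  define i0 where "i0 = 1 / rat_of_nat j ^ 2"
  have t2: "2 * t \<in> Zp p" using t by simp
  have u: "u \<in> Zp p" "qcong p 1 u u0" "2 * x - 1 \<noteq> 0"
    unfolding u_def u0_def e using p_multiple_plus_unit[OF t2, of "2 * j - 1"] j by blast+
  have v: "v \<in> Zp p" "qcong p 1 v v0" "2 * x + 1 \<noteq> 0"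
    unfolding v_def v0_def e using p_multiple_plus_unit[OF t2, of "2 * j + 1"] j by auto
  have u0: "u0 \<in> Zp p" unfolding u0_def using j by (intro Zp_inverse_of_nat[OF prime]) auto
  have i0: "i0 \<in> Zp p" unfolding i0_def using j by (intro inverse_square_Zp) auto
  define P where "P = ((x - 1) gchoose (p - 1)) * ((- x - 1) gchoose (p - 1))"
  have P: "qcong p 3 P (?p ^ 2 * (t * (t + 1) * i0))"
    unfolding P_def i0_def x_def by (rule gchoose_product_cong[OF t j(1,2)])
  have "sum_upto p x / (2 * x + 1) = sum_upto p (x - 1) / (2 * (x - 1) + 1) + 2 * (u * v) * P"
    using sum_upto_step[OF u(3) v(3), of p] p_gt_3 by (simp add: P_def u_def v_def divide_inverse)
  also have "qcong p 3 \<dots> ((- (2 * t + 1) - ?p ^ 2 * (t * (t + 1) * (4 * inverse (of_nat (2 * r + 1)) + 2 * H2 r)))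
      + 2 * (u * v) * (?p ^ 2 * (t * (t + 1) * i0)))"
    using Suc.IH j u v P unfolding x1
    by (intro qcong_add[OF prime] qcong_cmult[OF prime]) (auto simp: j_def)
  also have "inverse (of_nat (2 * r + 1)) = u0" by (simp add: u0_def j_def)
  also have "2 * (u * v) * (?p ^ 2 * (t * (t + 1) * i0)) = ?p ^ 2 * ((2 * (t * (t + 1) * i0)) * (u * v))"
    by (simp only: mult_ac)
  also have "qcong p 3
      ((- (2 * t + 1) - ?p ^ 2 * (t * (t + 1) * (4 * u0 + 2 * H2 r)))
        + ?p ^ 2 * ((2 * (t * (t + 1) * i0)) * (u * v)))
      ((- (2 * t + 1) - ?p ^ 2 * (t * (t + 1) * (4 * u0 + 2 * H2 r)))
        + ?p ^ 2 * ((2 * (t * (t + 1) * i0)) * (u0 * v0)))"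
    using t u v u0 i0
    by (intro qcong_add[OF prime] qcong_scale_3 qcong_cmult[OF prime] qcong_mult[OF prime]) auto
  also have "(- (2 * t + 1) - ?p ^ 2 * (t * (t + 1) * (4 * u0 + 2 * H2 r)))
        + ?p ^ 2 * ((2 * (t * (t + 1) * i0)) * (u0 * v0))
      = - (2 * t + 1) - ?p ^ 2 * (t * (t + 1) * ((4 * u0 - 2 * (i0 * (u0 * v0))) + 2 * H2 r))"
    by (simp add: algebra_simps)
  \<comment> \<open>Partial fractions: 2 / (j^2 (4j^2 - 1)) = 4 / (2j - 1) - 4 / (2j + 1) - 2 / j^2.
    The odd reciprocals telescope, and the squares accumulate in \<open>H2\<close>.\<close>
  also have "4 * u0 - 2 * (i0 * (u0 * v0)) = 4 * v0 + 2 * i0"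
  proof -
    define y where "y = rat_of_nat j"
    have y: "y \<noteq> 0" "2 * y - 1 \<noteq> 0" "2 * y + 1 \<noteq> 0"
      using j of_nat_odd_neq_0[of j] of_nat_odd_neq_0[of "Suc j"] by (auto simp: y_def)
    have v: "u0 = inverse (2 * y - 1)" "v0 = inverse (2 * y + 1)" "i0 = 1 / y\<^sup>2"
      using j by (simp_all add: u0_def v0_def i0_def y_def of_nat_diff)
    have uy: "u0 * (2 * y - 1) = 1" and vy: "v0 * (2 * y + 1) = 1" and iy: "i0 * y\<^sup>2 = 1"
      unfolding v using y by simp_all
    have "u0 - v0 = u0 * (v0 * (2 * y + 1)) - v0 * (u0 * (2 * y - 1))"
      by (simp only: uy vy mult_1_right)
    also have "\<dots> = 2 * (u0 * v0)" by (simp add: algebra_simps)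
    finally have "4 * u0 - 4 * v0 = 8 * (u0 * v0)" by simp
    have "1 + u0 * v0 = (u0 * (2 * y - 1)) * (v0 * (2 * y + 1)) + u0 * v0"
      by (simp only: uy vy mult_1_right)
    also have "\<dots> = y\<^sup>2 * (4 * (u0 * v0))" by (simp add: algebra_simps power2_eq_square)
    finally have "i0 * (1 + u0 * v0) = (i0 * y\<^sup>2) * (4 * (u0 * v0))" by simp
    then have "i0 * (1 + u0 * v0) = 4 * (u0 * v0)" by (simp only: iy mult_1_left)
    with \<open>4 * u0 - 4 * v0 = 8 * (u0 * v0)\<close> show ?thesis by (simp add: distrib_left)
  qed
  also have "4 * v0 + 2 * i0 + 2 * H2 r = 4 * v0 + 2 * H2 j"
    by (simp add: H2_Suc j_def i0_def)
  finally show ?case by (simp add: x_def v0_def j_def)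
qed

text \<open>Multiplying the quotient by 2a + 1, which is 2r + 1 modulo p, turns 4 / (2r + 1) into 4;
  since -a is -r modulo p, \<open>bernpoly_H2\<close> supplies the Bernoulli value.\<close>

lemma sum_upto_lower_half:
  assumes t: "t \<in> Zp p" and r: "2 * r + 1 < p"
  defines "a \<equiv> of_nat p * t + of_nat r"
  shows "qcong p 3 (sum_upto p a)
    (- (2 * a + 1) * (2 * t + 1)
      - of_nat p ^ 2 * (t * (t + 1) * (4 + (2 * a + 1) * bernpoly (p - 2) (- a))))"
proof -
  let ?p = "rat_of_nat p"
  have a: "a \<in> Zp p" using t by (simp add: a_def)
  have e: "2 * a + 1 = ?p * (2 * t) + of_nat (2 * r + 1)" by (simp add: a_def)
  define v where "v = inverse (rat_of_nat (2 * r + 1))"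
  have v: "v \<in> Zp p" unfolding v_def using r by (intro Zp_inverse_of_nat[OF prime]) auto
  have nz: "2 * a + 1 \<noteq> 0" unfolding e using t r by (intro p_multiple_plus_unit) auto
  have "qcong p 1 (2 * a + 1) (of_nat (2 * r + 1))"
    unfolding e using t by (intro qcong_1_p_multiple[OF prime]) auto
  from qcong_cmult[OF prime this v] have a1: "qcong p 1 (v * (2 * a + 1)) 1"
    by (simp add: v_def del: of_nat_add of_nat_mult of_nat_Suc)
  have "qcong p 1 (bernpoly (p - 2) (- a)) (bernpoly (p - 2) (- of_nat r))"
    unfolding a_def using qcong_minus[OF prime qcong_1_p_multiple[OF prime t, of "of_nat r"]] p_gt_3
    by (intro bernpoly_cong) auto
  also have "qcong p 1 \<dots> (2 * H2 r)" using r by (intro bernpoly_H2) simp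
  finally have B: "qcong p 1 (2 * H2 r) (bernpoly (p - 2) (- a))" by (rule qcong_sym[OF prime])
  have "sum_upto p a = (2 * a + 1) * (sum_upto p a / (2 * a + 1))" using nz by simp
  also have "qcong p 3 \<dots> ((2 * a + 1) * (- (2 * t + 1) - ?p ^ 2 * (t * (t + 1) * (4 * v + 2 * H2 r))))"
    using a sum_upto_quotient[OF t r] unfolding a_def[symmetric] v_def[symmetric]
    by (intro qcong_cmult[OF prime]) auto
  also have "\<dots> = - (2 * a + 1) * (2 * t + 1)
      - ?p ^ 2 * (t * (t + 1) * (4 * (v * (2 * a + 1)) + (2 * a + 1) * (2 * H2 r)))"
    by (simp add: algebra_simps)
  also have "qcong p 3 \<dots> (- (2 * a + 1) * (2 * t + 1)
      - ?p ^ 2 * (t * (t + 1) * (4 * 1 + (2 * a + 1) * bernpoly (p - 2) (- a))))"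
    using t a a1 B
    by (intro qcong_diff[OF prime] qcong_scale_3 qcong_cmult[OF prime] qcong_add[OF prime]) auto
  finally show ?thesis by simp
qed

text \<open>The reflection a -> -1 - a sends t to -1 - t and r to p - 1 - r, exchanging the two
  halves of the residues. On the right 2a + 1, 2t + 1 and the Bernoulli value change sign and t(t +
  1) is fixed, so the whole expression is invariant.\<close>

lemma sum_upto_cong:
  assumes t: "t \<in> Zp p" and r: "r < p" "2 * r + 1 \<noteq> p"
  defines "a \<equiv> of_nat p * t + of_nat r"
  shows "qcong p 3 (sum_upto p a)
    (- (2 * a + 1) * (2 * t + 1)
      - of_nat p ^ 2 * (t * (t + 1) * (4 + (2 * a + 1) * bernpoly (p - 2) (- a))))"
proof (cases "2 * r + 1 < p")
  case True
  then show ?thesis unfolding a_def by (rule sum_upto_lower_half[OF t])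
next
  case False
  define s where "s = p - 1 - r"
  have s: "2 * s + 1 < p" using False r by (simp add: s_def)
  have t': "- 1 - t \<in> Zp p" using t by simp
  have e: "of_nat p * (- 1 - t) + of_nat s = - 1 - a"
    using r by (simp add: s_def a_def of_nat_diff algebra_simps)
  have B: "bernpoly (p - 2) (- (- 1 - a)) = - bernpoly (p - 2) (- a)"
    using bernpoly_reflect[of "p - 2" "- a"] odd_p p_gt_3 by (simp add: add.commute)
  from sum_upto_lower_half[OF t' s] show ?thesis
    unfolding e sum_upto_reflect B by (simp add: algebra_simps)
qed

section \<open>Least residues and the conclusion\<close>

lemma least_residue:
  assumes "a \<in> Zp p"
  shows "least_residue p a < p" and "qcong p 1 a (of_nat (least_residue p a))"
proof -
  obtain n d where nd: "\<not> int p dvd d" "a = of_int n / of_int d"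
    using assms Zp_iff_fraction[OF prime] by metis
  then have "coprime d (int p)"
    using prime by (metis coprime_commute prime_imp_coprime prime_nat_int_transfer)
  then obtain x where x: "[d * x = 1] (mod int p)" using cong_solve_coprime_int by blast
  \<comment> \<open>As \<open>x\<close> inverts the denominator \<open>d\<close> modulo p, this is n
    / d reduced modulo p.\<close>
  define r where "r = nat (n * x mod int p)"
  have p: "int p > 0" using p_gt_3 by simp
  then have r: "r < p" "int r = n * x mod int p"
    by (simp_all add: r_def nat_less_iff)
  have "[d * int r = d * (n * x)] (mod int p)"
    unfolding r(2) by (intro cong_mult) simp_all
  also have "d * (n * x) = n * (d * x)" by simp
  also have "[n * (d * x) = n * 1] (mod int p)" using x by (intro cong_mult) simp_all
  finally have "qcong p 1 (of_int (d * int r)) (of_int n)"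
    by (simp only: qcong_of_int[OF prime] mult_1_right)
  from qcong_cmult[OF prime this Zp_inverse_of_int[OF prime nd(1)]]
  have c: "qcong p 1 (inverse (of_int d) * of_int (d * int r)) (inverse (of_int d) * of_int n)" .
  have e: "inverse (of_int d) * of_int (d * int r) = rat_of_nat r"
    using nd(1) by (cases "d = 0") simp_all
  have "inverse (of_int d) * of_int n = a"
    unfolding nd(2) divide_inverse by (rule mult.commute)
  from c[unfolded e this] have "qcong p 1 (of_nat r) a" .
  then have ra: "qcong p 1 a (of_nat r)" by (rule qcong_sym[OF prime])
  have unique: "s = r" if "s < p" "qcong p 1 a (of_nat s)" for s
  proof -
    have "qcong p 1 (of_int (int s)) (of_int (int r))"
      using qcong_trans[OF prime qcong_sym[OF prime that(2)] ra] by simp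
    then have "[s = r] (mod p)" by (simp only: qcong_of_int[OF prime] cong_int_iff)
    then show ?thesis using that(1) r(1) by (rule cong_less_modulus_unique_nat)
  qed
  have "least_residue p a = r"
    unfolding least_residue_def
  proof (rule the_equality)
    show "r < p \<and> qcong p 1 a (of_nat r)" using r(1) ra by blast
    show "s = r" if "s < p \<and> qcong p 1 a (of_nat s)" for s
      using that unique by blast
  qed
  then show "least_residue p a < p" "qcong p 1 a (of_nat (least_residue p a))"
    using r(1) ra by (simp_all only:)
qed

end

theorem theorem4p1:
  fixes p :: nat and a t :: rat
  assumes "prime p" and "p > 3"
    and "a \<in> Zp p"
    and "\<not> qcong p 1 a 0" and "\<not> qcong p 1 a (- 1)"
    and "\<not> qcong p 1 a (1 / 2)" and "\<not> qcong p 1 a (- (1 / 2))"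
    and "t = (a - of_nat (least_residue p a)) / of_nat p"
  shows "qcong p 3
    (\<Sum>k = 0..p - 1. (a gchoose k) * ((- 1 - a) gchoose k) * (1 / (2 * of_nat k - 1)))
    (- (2 * a + 1) * (2 * t + 1)
       - of_nat p ^ 2 * t * (t + 1) * (4 + (2 * a + 1) * bernpoly (p - 2) (- a)))"
proof -
  note prime = \<open>prime p\<close>
  let ?p = "rat_of_nat p"
  define r where "r = least_residue p a"
  have r: "r < p" "qcong p 1 a (of_nat r)"
    using least_residue[OF assms(1-3)] by (simp_all add: r_def)
  have t: "t \<in> Zp p" using r(2) by (simp add: qcong_def r_def assms(8))
  have a: "a = ?p * t + of_nat r" using p_nonzero[OF prime] by (simp add: assms(8) r_def)
  have "2 * r + 1 \<noteq> p"
  proof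
    assume "2 * r + 1 = p"
    then have "?p = 2 * of_nat r + 1" by (metis of_nat_1 of_nat_add of_nat_mult of_nat_numeral)
    \<comment> \<open>The middle residue r = (p - 1) / 2 is -1/2 modulo p, a class excluded for
      a.\<close>
    then have "a = - (1 / 2) + ?p ^ 1 * (t + 1 / 2)" unfolding a by (simp add: field_simps)
    moreover have "1 / 2 \<in> Zp p"
      using Zp_inverse_of_nat[OF prime, of 2] assms(2) by (simp add: inverse_eq_divide)
    then have "t + 1 / 2 \<in> Zp p" using Zp_add[OF prime t] by blast
    ultimately have "qcong p 1 a (- (1 / 2))" unfolding qcong_iff[OF prime] by blast
    with assms(7) show False by simp
  qed
  from sum_upto_cong[OF assms(1,2) t r(1) this]
  have "qcong p 3 (sum_upto p a) (- (2 * a + 1) * (2 * t + 1)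
      - ?p ^ 2 * (t * (t + 1) * (4 + (2 * a + 1) * bernpoly (p - 2) (- a))))"
    unfolding a .
  moreover have "{0..p - 1} = {..<p}" using assms(2) by auto
  ultimately show ?thesis
    by (simp only: sum_upto_def sum_term_def mult.assoc)
qed

end
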